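(* For every integer $d\geq 2$, \[\kappa_d\geq \begin{cases} 2^d/(d+1) & \text{if } d \text{ is odd};\\ 2^{d-1}/d & \text{if } d \text{ is even.}\end{cases}\]
   Context: For an integer $d\geq 2$, consider a finite simple $(d-1)$-uniform hypergraph $H$ (no hyperedge appears twice) in which each hyperedge receives exactly one of $d$ colors $c_1,\ldots,c_d$. Let $C_i$ be the number of hyperedges of color $c_i$, and let $T$ be the number of rainbow $K^{(d-1)}_d$'s in $H$, i.e. the number of $d$-subsets of $V(H)$ all of whose $d$ subsets of size $d-1$ are hyperedges of $H$ and these $d$ hyperedges have $d$ distinct colors. Define $\kappa_d$ to be the supremum of the ratio $T^{d-1}/(C_1C_2\cdots C_d)$ over all such colored hypergraphs (with all $C_i>0$). *)

theory Defs
  imports Complex_Main "HOL-Library.Extended_Real" "HOL-Library.Ramsey"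
begin

text \<open>The set \<open>nsets A k\<close> consists of the \<open>k\<close>-element subsets of \<open>A\<close>.
  The colours \<open>c_1, \<dots>, c_d\<close> are the numbers \<open>1, \<dots>, d\<close>; values of \<open>c\<close> outside \<open>E\<close> are irrelevant.\<close>

definition colored_hypergraph :: "nat \<Rightarrow> 'a set \<Rightarrow> 'a set set \<Rightarrow> ('a set \<Rightarrow> nat) \<Rightarrow> bool" where
  "colored_hypergraph d V E c \<longleftrightarrow>
     finite V \<and> E \<subseteq> nsets V (d - 1) \<and> (\<forall>e\<in>E. c e \<in> {1..d})"

definition color_count :: "'a set set \<Rightarrow> ('a set \<Rightarrow> nat) \<Rightarrow> nat \<Rightarrow> nat" where
  "color_count E c i = card {e \<in> E. c e = i}"

definition rainbow_simplices ::
    "nat \<Rightarrow> 'a set \<Rightarrow> 'a set set \<Rightarrow> ('a set \<Rightarrow> nat) \<Rightarrow> 'a set set" where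
  "rainbow_simplices d V E c =
     {S \<in> nsets V d. nsets S (d - 1) \<subseteq> E \<and> inj_on c (nsets S (d - 1))}"

text \<open>The supremum is taken in the extended reals, so that it is meaningful without a proof that
  the ratios are bounded. Every finite hypergraph is isomorphic to one whose vertices are natural
  numbers, so restricting to these does not change the supremum.\<close>

definition kappa :: "nat \<Rightarrow> ereal" where
  "kappa d = Sup {ereal (real (card (rainbow_simplices d V E c)) ^ (d - 1)
                         / (\<Prod>i = 1..d. real (color_count E c i)))
                  | (V :: nat set) E c.
                      colored_hypergraph d V E c \<and> (\<forall>i\<in>{1..d}. color_count E c i > 0)}"

end

theory Submission
  imports Defs "HOL-Number_Theory.Cong"
begin

text \<open>For odd \<open>d\<close>, take all \<open>(d-1)\<close>-subsets of a set of \<open>d+1\<close> points. Complementation identifies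
  them with the edges of the complete graph on \<open>d+1\<close> vertices, and the \<open>d\<close>-subsets with its
  vertices; a simplex is rainbow iff the edges at the corresponding vertex have distinct colours.
  Hence a one-factorization with \<open>d\<close> colours gives \<open>T = d + 1\<close> and \<open>C\<^sub>i = (d + 1) / 2\<close>.
  For even \<open>d\<close>, cone off the hypergraph for \<open>d - 1\<close>: join a new vertex to every edge, and give the
  new colour \<open>d\<close> to the rainbow simplices. This leaves the ratio unchanged.\<close>

section \<open>Faces of a rainbow simplex and admissible ratios\<close>

lemma card_nsets_finite:
  assumes "finite A"
  shows "card (nsets A k) = card A choose k"
proof -
  have "nsets A k = {B. B \<subseteq> A \<and> card B = k}"
    using assms by (auto simp: nsets_def intro: finite_subset)
  then show ?thesis using assms by (simp add: n_subsets)
qed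

lemma finite_rainbow_simplices:
  assumes "colored_hypergraph d V E c"
  shows "finite (rainbow_simplices d V E c)"
  using assms finite_imp_finite_nsets[of V d]
  by (auto simp: colored_hypergraph_def rainbow_simplices_def)

text \<open>The \<open>d\<close> faces of one rainbow simplex have distinct colours among
  \<open>d\<close> possible ones, so every colour occurs on them. Thus a single rainbow simplex
  supplies the positivity condition in \<open>kappa\<close>.\<close>

lemma color_count_pos_of_rainbow:
  assumes H: "colored_hypergraph d V E c" and S: "S \<in> rainbow_simplices d V E c"
    and d: "d \<ge> 1" and i: "i \<in> {1..d}"
  shows "color_count E c i > 0"
proof -
  have fS: "finite S" "card S = d" and sub: "nsets S (d - 1) \<subseteq> E"
    and inj: "inj_on c (nsets S (d - 1))"
    using S by (auto simp: rainbow_simplices_def nsets_def)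
  have "d choose (d - 1) = d"
    using d binomial_symmetric[of "d - 1" d] by simp
  then have "card (c ` nsets S (d - 1)) = d"
    using fS unfolding card_image[OF inj] by (simp add: card_nsets_finite)
  moreover have "c ` nsets S (d - 1) \<subseteq> {1..d}"
    using sub H by (auto simp: colored_hypergraph_def)
  ultimately have "c ` nsets S (d - 1) = {1..d}"
    by (intro card_subset_eq) auto
  then obtain e where "e \<in> E" "c e = i"
    using i sub by (smt (verit) imageE subsetD)
  moreover have "finite E"
    using H finite_imp_finite_nsets[of V "d - 1"]
    by (auto simp: colored_hypergraph_def intro: finite_subset)
  ultimately show ?thesis
    by (auto simp: color_count_def card_gt_0_iff)
qed

lemma kappa_ge_ratio:
  fixes V :: "nat set"
  assumes "colored_hypergraph d V E c" and "rainbow_simplices d V E c \<noteq> {}" and "d \<ge> 1"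
  shows "ereal (real (card (rainbow_simplices d V E c)) ^ (d - 1)
           / (\<Prod>i = 1..d. real (color_count E c i))) \<le> kappa d"
  unfolding kappa_def
  using assms color_count_pos_of_rainbow[OF assms(1)]
  by (intro Sup_upper) blast

section \<open>Coning: from \<open>d\<close> to \<open>Suc d\<close>\<close>

lemma nsets_insert_Suc:
  assumes "w \<notin> S"
  shows "nsets (insert w S) (Suc k) = nsets S (Suc k) \<union> insert w ` nsets S k"
proof (intro equalityI subsetI)
  fix e assume e: "e \<in> nsets (insert w S) (Suc k)"
  show "e \<in> nsets S (Suc k) \<union> insert w ` nsets S k"
  proof (cases "w \<in> e")
    case True
    then have "e - {w} \<in> nsets S k" "e = insert w (e - {w})"
      using e by (auto simp: nsets_def)
    then show ?thesis by blast
  next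
    case False
    then show ?thesis using e by (auto simp: nsets_def)
  qed
next
  fix e assume "e \<in> nsets S (Suc k) \<union> insert w ` nsets S k"
  then show "e \<in> nsets (insert w S) (Suc k)"
  proof
    assume "e \<in> insert w ` nsets S k"
    then obtain a where "a \<in> nsets S k" "e = insert w a" by blast
    moreover have "w \<notin> a" using calculation assms by (auto simp: nsets_def)
    ultimately show ?thesis by (auto simp: nsets_def)
  qed (auto simp: nsets_def)
qed

text \<open>The cone has at least as many rainbow simplices as the base, old colour counts persist,
  and the new colour class has exactly as many edges as the base has rainbow simplices. That extra
  factor in the denominator cancels the extra power in the numerator.\<close>

lemma kappa_Suc_ge_ratio:
  fixes V :: "nat set"
  assumes H: "colored_hypergraph d V E c" and ne: "rainbow_simplices d V E c \<noteq> {}"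
    and d: "d \<ge> 1"
  shows "ereal (real (card (rainbow_simplices d V E c)) ^ (d - 1)
           / (\<Prod>i = 1..d. real (color_count E c i))) \<le> kappa (Suc d)"
proof -
  obtain k where k: "d = Suc k" using d by (cases d) auto
  define R where "R = rainbow_simplices d V E c"
  have fV: "finite V" and EV: "E \<subseteq> nsets V k" and cE: "\<And>e. e \<in> E \<Longrightarrow> c e \<in> {1..d}"
    using H k by (auto simp: colored_hypergraph_def)
  obtain w where w: "w \<notin> V"
    using fV by (metis ex_new_if_finite infinite_UNIV_nat)
  have wE: "w \<notin> e" if "e \<in> E" for e using that EV w by (auto simp: nsets_def)
  have RV: "R \<subseteq> nsets V d" by (auto simp: R_def rainbow_simplices_def)
  have wR: "w \<notin> S" if "S \<in> R" for S using that RV w by (auto simp: nsets_def)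
  define E' where "E' = insert w ` E \<union> R"
  \<comment> \<open>The members of \<open>E'\<close> that avoid \<open>w\<close> are exactly those
    of \<open>R\<close>; they get the new colour, while cones inherit the colour of their
    base.\<close>
  define c' where "c' = (\<lambda>e. if w \<in> e then c (e - {w}) else Suc d)"
  have c'_insert: "c' (insert w e) = c e" if "w \<notin> e" for e
    using that by (simp add: c'_def)
  have c'_R: "c' S = Suc d" if "w \<notin> S" for S
    using that by (simp add: c'_def)
  have "E' \<subseteq> nsets (insert w V) d"
    using EV RV w unfolding E'_def k nsets_insert_Suc[OF w] by auto
  moreover have "c' e \<in> {1..Suc d}" if "e \<in> E'" for e
    using that cE wE wR by (force simp: E'_def c'_insert c'_R)
  ultimately have H': "colored_hypergraph (Suc d) (insert w V) E' c'"
    using fV by (auto simp: colored_hypergraph_def)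
  have RR: "insert w ` R \<subseteq> rainbow_simplices (Suc d) (insert w V) E' c'"
  proof
    fix S' assume "S' \<in> insert w ` R"
    then obtain S where S: "S \<in> R" "S' = insert w S" by blast
    have wS: "w \<notin> S" using S wR by blast
    have Sd: "S \<in> nsets V d" "nsets S k \<subseteq> E" "inj_on c (nsets S k)"
      using S k by (auto simp: R_def rainbow_simplices_def)
    have "nsets S d = {S}"
      using Sd(1) by (auto simp: nsets_def dest: card_subset_eq)
    then have faces: "nsets S' d = insert S (insert w ` nsets S k)"
      unfolding S(2) k nsets_insert_Suc[OF wS] by simp
    have wk: "w \<notin> e" if "e \<in> nsets S k" for e using that wS by (auto simp: nsets_def)
    have "inj_on c' (insert w ` nsets S k)"
      using Sd(3) by (auto simp: inj_on_def c'_insert wk)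
    moreover have "c' S \<notin> c' ` (insert w ` nsets S k)"
    proof
      assume "c' S \<in> c' ` (insert w ` nsets S k)"
      then obtain e where "e \<in> nsets S k" "Suc d = c e"
        using wS by (auto simp: c'_insert c'_R wk)
      then show False using cE[of e] Sd(2) by auto
    qed
    ultimately have "inj_on c' (nsets S' d)"
      unfolding faces by (subst inj_on_insert) auto
    moreover have "nsets S' d \<subseteq> E'"
      using S Sd(2) unfolding faces E'_def by auto
    moreover have "S' \<in> nsets (insert w V) (Suc d)"
      using S(2) Sd(1) w by (simp add: nsets_insert_Suc)
    ultimately show "S' \<in> rainbow_simplices (Suc d) (insert w V) E' c'"
      by (simp add: rainbow_simplices_def)
  qed
  let ?T = "card R" and ?T' = "card (rainbow_simplices (Suc d) (insert w V) E' c')"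
  have fR: "finite R" unfolding R_def by (rule finite_rainbow_simplices[OF H])
  have T0: "?T > 0" using ne fR by (simp add: R_def card_gt_0_iff)
  have "inj_on (insert w) R" using wR by (meson inj_onI insert_ident)
  then have TT: "?T \<le> ?T'"
    using card_mono[OF finite_rainbow_simplices[OF H'] RR] by (simp add: card_image)
  have old: "color_count E' c' i = color_count E c i" if "i \<in> {1..d}" for i
  proof -
    have "{e \<in> E'. c' e = i} = insert w ` {e \<in> E. c e = i}"
      using that wE wR by (auto simp: E'_def c'_insert c'_R)
    moreover have "inj_on (insert w) {e \<in> E. c e = i}"
      using wE by (intro inj_onI) (metis (no_types, lifting) insert_ident mem_Collect_eq)
    ultimately show ?thesis by (simp add: color_count_def card_image)
  qed
  have "{e \<in> E'. c' e = Suc d} = R"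
    using cE wE wR by (fastforce simp: E'_def c'_insert c'_R)
  then have new: "color_count E' c' (Suc d) = ?T" by (simp add: color_count_def)
  have P: "(\<Prod>i = 1..Suc d. real (color_count E' c' i))
           = (\<Prod>i = 1..d. real (color_count E c i)) * real ?T"
    using old new by (subst prod.nat_ivl_Suc') (auto intro: prod.cong)
  have "real ?T ^ (d - 1) / (\<Prod>i = 1..d. real (color_count E c i))
        = real ?T ^ d / ((\<Prod>i = 1..d. real (color_count E c i)) * real ?T)"
    using T0 k by simp
  also have "\<dots> \<le> real ?T' ^ d / ((\<Prod>i = 1..d. real (color_count E c i)) * real ?T)"
    using TT by (intro divide_right_mono power_mono mult_nonneg_nonneg prod_nonneg) auto
  finally have "ereal (real ?T ^ (d - 1) / (\<Prod>i = 1..d. real (color_count E c i)))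
      \<le> ereal (real ?T' ^ (Suc d - 1) / (\<Prod>i = 1..Suc d. real (color_count E' c' i)))"
    unfolding P by simp
  also have "\<dots> \<le> kappa (Suc d)"
    using RR ne by (intro kappa_ge_ratio[OF H']) (auto simp: R_def)
  finally show ?thesis by (simp add: R_def)
qed

section \<open>Round-robin colouring and its complementary hypergraph\<close>

text \<open>The round-robin one-factorization of the complete graph on \<open>{..m}\<close>, for odd \<open>m\<close>: the pair
  \<open>{a, b}\<close> with \<open>a, b < m\<close> is coloured by \<open>a + b\<close> modulo \<open>m\<close>, and \<open>{a, m}\<close> gets the colour \<open>2a\<close>
  that is left over at \<open>a\<close>.\<close>

definition round_robin :: "nat \<Rightarrow> nat set \<Rightarrow> nat" where
  "round_robin m p = Suc ((if m \<in> p then 2 * \<Sum>(p - {m}) else \<Sum>p) mod m)"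

text \<open>At the vertex \<open>m\<close>, doubling is injective modulo \<open>m\<close> because
  \<open>m\<close> is odd. At any other \<open>v\<close>, translation by \<open>v\<close> is
  injective, and the pair \<open>{v, m}\<close> takes the value \<open>v + v\<close>, which no other
  pair at \<open>v\<close> has.\<close>

lemma round_robin_proper:
  assumes m: "odd m" and le: "v \<le> m" "u \<le> m" "u' \<le> m" and ne: "u \<noteq> v" "u' \<noteq> v"
    and eq: "round_robin m {v, u} = round_robin m {v, u'}"
  shows "u = u'"
proof (cases "v = m")
  case True
  have *: "{v, x} - {m} = {x}" if "x \<noteq> v" for x using that True by auto
  have "[2 * u = 2 * u'] (mod m)"
    using eq ne True by (simp add: round_robin_def cong_def * del: insert_Diff_single)
  then have "[u = u'] (mod m)"
    using m by (simp add: cong_mult_lcancel_nat)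
  then show ?thesis
    using le ne True by (intro cong_less_imp_eq_nat[of _ m]) auto
next
  case False
  \<comment> \<open>Replacing \<open>m\<close> by \<open>v\<close> writes every colour at
    \<open>v\<close> as a translate \<open>v + h x\<close>. The values of \<open>h\<close> lie below
    \<open>m\<close>, and \<open>h\<close> is injective on vertices other than
    \<open>v\<close>.\<close>
  define h where "h x = (if x = m then v else x)" for x
  have *: "round_robin m {v, x} = Suc ((v + h x) mod m)" if "x \<noteq> v" for x
  proof (cases "x = m")
    case True
    then have "{v, x} - {m} = {v}" using False by auto
    then show ?thesis using True by (simp add: round_robin_def h_def mult_2)
  next
    case neq: False
    then show ?thesis using False that by (auto simp: round_robin_def h_def)
  qed
  have "[v + h u = v + h u'] (mod m)"
    using eq ne by (simp add: * cong_def)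
  then have "[h u = h u'] (mod m)"
    by (simp add: cong_add_lcancel_nat)
  then have "h u = h u'"
    using le False by (intro cong_less_imp_eq_nat[of _ m]) (auto simp: h_def)
  then show ?thesis
    using ne by (auto simp: h_def split: if_splits)
qed

lemma one_factorization_hypergraph:
  assumes m: "odd m"
  obtains E :: "nat set set" and c
  where "colored_hypergraph m {..m} E c" "rainbow_simplices m {..m} E c = nsets {..m} m"
    and "\<And>i. 2 * color_count E c i \<le> m + 1"
proof -
  let ?V = "{..m}"
  define E where "E = nsets ?V (m - 1)"
  define c where "c e = round_robin m (?V - e)" for e
  have m0: "m > 0" using m by (cases m) auto
  have compl: "card (?V - e) = 2" "?V - (?V - e) = e" if "e \<in> E" for e
    using that m0 by (auto simp: E_def nsets_def card_Diff_subset)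
  have pair: "\<exists>u. ?V - e = {v, u} \<and> u \<noteq> v \<and> u \<le> m"
    if e: "e \<in> E" and v: "v \<in> ?V - e" for e v
  proof -
    obtain a b where ab: "?V - e = {a, b}" "a \<noteq> b"
      using compl(1)[OF e] by (auto simp: card_2_iff)
    have "a \<in> ?V - e" "b \<in> ?V - e" unfolding ab(1) by auto
    then have "a \<le> m" "b \<le> m" by auto
    moreover have "v = a \<or> v = b" using v unfolding ab(1) by blast
    moreover have "?V - e = {b, a}" using ab(1) by (simp only: insert_commute)
    ultimately show ?thesis using ab by blast
  qed
  \<comment> \<open>Properness in complementary form: \<open>v\<close> lies outside both edges, so
    their complements are pairs meeting at \<open>v\<close>.\<close>
  have same: "e = e'"
    if e: "e \<in> E" "v \<in> ?V - e" and e': "e' \<in> E" "v \<in> ?V - e'" and eq: "c e = c e'" for e e' v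
  proof -
    obtain u where u: "?V - e = {v, u}" "u \<noteq> v" "u \<le> m" using pair[OF e] by blast
    obtain u' where u': "?V - e' = {v, u'}" "u' \<noteq> v" "u' \<le> m" using pair[OF e'] by blast
    have "round_robin m {v, u} = round_robin m {v, u'}"
      using eq unfolding c_def u(1) u'(1) .
    then have "u = u'"
      using round_robin_proper[OF m _ u(3) u'(3) u(2) u'(2)] e(2) by simp
    then have "?V - e = ?V - e'" unfolding u(1) u'(1) by simp
    then show ?thesis using compl(2)[OF e(1)] compl(2)[OF e'(1)] by metis
  qed
  \<comment> \<open>The \<open>Suc\<close> in \<open>round_robin\<close> shifts the residues modulo
    \<open>m\<close> to the colours \<open>{1..m}\<close>.\<close>
  have "colored_hypergraph m ?V E c"
    using m0 by (auto simp: colored_hypergraph_def E_def c_def round_robin_def Suc_le_eq)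
  moreover have "rainbow_simplices m ?V E c = nsets ?V m"
  proof -
    have "nsets S (m - 1) \<subseteq> E \<and> inj_on c (nsets S (m - 1))" if S: "S \<in> nsets ?V m" for S
    proof
      show sub: "nsets S (m - 1) \<subseteq> E"
        using S by (auto simp: nsets_def E_def)
      have "card (?V - S) = 1"
        using S by (auto simp: nsets_def card_Diff_subset)
      \<comment> \<open>All faces of \<open>S\<close> miss this \<open>v\<close>, so
        \<open>same\<close> forces their colours apart.\<close>
      then obtain v where v: "v \<in> ?V - S" by (metis card.empty ex_in_conv zero_neq_one)
      then have "v \<in> ?V - e" if "e \<in> nsets S (m - 1)" for e
        using that by (auto simp: nsets_def)
      then show "inj_on c (nsets S (m - 1))"
        using sub same by (intro inj_onI) blast
    qed
    then show ?thesis by (auto simp: rainbow_simplices_def)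
  qed
  moreover have "2 * color_count E c i \<le> m + 1" for i
  proof -
    let ?M = "(\<lambda>e. ?V - e) ` {e \<in> E. c e = i}"
    have "inj_on (\<lambda>e. ?V - e) {e \<in> E. c e = i}"
      by (rule inj_on_inverseI[where g = "\<lambda>p. ?V - p"]) (simp add: compl)
    then have "card ?M = color_count E c i"
      by (simp add: color_count_def card_image)
    \<comment> \<open>By \<open>same\<close>, the complements of the edges of one colour form a
      matching on \<open>m + 1\<close> points.\<close>
    moreover have "2 * card ?M = card (\<Union>?M)"
    proof (rule card_partition)
      show "finite (\<Union>?M)" by (rule finite_subset[of _ ?V]) auto
      then show "finite ?M" by (rule finite_UnionD)
      show "card p = 2" if "p \<in> ?M" for p using that compl by auto
      show "p \<inter> q = {}" if "p \<in> ?M" "q \<in> ?M" "p \<noteq> q" for p q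
        using that same by fastforce
    qed
    moreover have "card (\<Union>?M) \<le> card ?V" by (rule card_mono) auto
    ultimately show ?thesis by simp
  qed
  ultimately show thesis by (rule that)
qed

section \<open>From the colour counts to the bounds\<close>

text \<open>Multiply the \<open>m\<close> inequalities
  \<open>2 * color_count E c i \<le> m + 1\<close>; positivity of the counts permits the
  division.\<close>

lemma ratio_le_of_color_count_le:
  assumes pos: "\<And>i. i \<in> {1..m} \<Longrightarrow> color_count E c i > 0"
    and le: "\<And>i. 2 * color_count E c i \<le> m + 1" and m: "m > 0"
  shows "2 ^ m / (real m + 1)
           \<le> (real m + 1) ^ (m - 1) / (\<Prod>i = 1..m. real (color_count E c i))"
proof -
  have "2 ^ m * (\<Prod>i = 1..m. real (color_count E c i)) = (\<Prod>i = 1..m. 2 * real (color_count E c i))"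
    by (simp add: prod.distrib)
  also have "\<dots> \<le> (\<Prod>i = 1..m. real m + 1)"
  proof (intro prod_mono conjI)
    show "2 * real (color_count E c i) \<le> real m + 1" for i
      using of_nat_mono[OF le[of i], where 'a = real] by simp
  qed simp
  also have "\<dots> = (real m + 1) ^ (m - 1) * (real m + 1)"
    using m power_minus_mult[of m "real m + 1"] by simp
  finally have "2 ^ m * (\<Prod>i = 1..m. real (color_count E c i)) \<le> (real m + 1) ^ (m - 1) * (real m + 1)" .
  moreover have "(\<Prod>i = 1..m. real (color_count E c i)) > 0"
    using pos by (intro prod_pos) auto
  ultimately show ?thesis by (simp add: field_simps)
qed

text \<open>The same hypergraph serves twice: directly for \<open>m\<close>, and through its cone
  for \<open>Suc m\<close>.\<close>

lemma kappa_ge_of_odd: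
  assumes m: "odd m"
  shows "ereal (2 ^ m / (real m + 1)) \<le> kappa m"
    and "ereal (2 ^ m / (real m + 1)) \<le> kappa (Suc m)"
proof -
  have m0: "m \<ge> 1" using m by (cases m) auto
  obtain E c where H: "colored_hypergraph m {..m} E c"
    and R: "rainbow_simplices m {..m} E c = nsets {..m} m"
    and le: "\<And>i. 2 * color_count E c i \<le> m + 1"
    using one_factorization_hypergraph[OF m] by blast
  have T: "card (rainbow_simplices m {..m} E c) = m + 1"
    by (simp add: R card_nsets_finite)
  then have ne: "rainbow_simplices m {..m} E c \<noteq> {}" by auto
  have "ereal (2 ^ m / (real m + 1)) \<le> ereal (real (card (rainbow_simplices m {..m} E c)) ^ (m - 1)
           / (\<Prod>i = 1..m. real (color_count E c i)))"
    using ratio_le_of_color_count_le[of m E c] color_count_pos_of_rainbow[OF H _ m0] ne le m0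
    by (fastforce simp: T add.commute)
  from order_trans[OF this kappa_ge_ratio[OF H ne m0]]
    order_trans[OF this kappa_Suc_ge_ratio[OF H ne m0]]
  show "ereal (2 ^ m / (real m + 1)) \<le> kappa m"
    and "ereal (2 ^ m / (real m + 1)) \<le> kappa (Suc m)" .
qed

theorem theorem3p4:
  fixes d :: nat
  assumes "d \<ge> 2"
  shows "kappa d \<ge> ereal (if odd d then 2 ^ d / (real d + 1) else 2 ^ (d - 1) / real d)"
proof (cases "odd d")
  case True
  then show ?thesis using kappa_ge_of_odd(1) by simp
next
  case False
  then obtain m where "d = Suc m" "odd m" using assms by (cases d) auto
  then show ?thesis using kappa_ge_of_odd(2)[of m] by (simp add: add.commute)
qed

end
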